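(* Let $n \ge 2$ be an integer. Start at the permutation $n\,(n{-}1)\,\cdots\,2\,1$ (one-line notation) and, reading the bits of $S_n = x_1 x_2 \cdots x_{n!}$ from left to right, apply $\phi(x_1), \phi(x_2), \ldots, \phi(x_{n!})$ in succession. Then the resulting sequence of permutations $\phi(S_n)$ is a Hamilton cycle in the directed Cayley graph $\Xi_n$: the $n!$ permutations visited (the starting one and the results of the first $n!-1$ applications) are exactly all the permutations of $\{1,\ldots,n\}$, each visited once, and the last application returns to the starting permutation.
   Context: For $1\le k \le n$, let $\sigma_k = (1\ 2\ \cdots\ k)$, acting on positions of a permutation written in one-line notation: $\sigma_k(x_1 x_2 \cdots x_n) = x_2 x_3 \cdots x_k\, x_1\, x_{k+1} \cdots x_n$. The directed Cayley graph $\Xi_n = \overrightarrow{\mathrm{Cay}}(\{\sigma_n,\sigma_{n-1}\} : \mathbb{S}_n)$ has as vertices all permutations of $\{1,\ldots,n\}$ and directed edges $g \to \sigma_n g$ and $g \to \sigma_{n-1} g$. Binary strings $S_n$ of length $n!$ are defined recursively: $S_2 = 00$, and for $n \ge 2$, if $S_n = x_1 x_2 \cdots x_{n!}$ then $S_{n+1} = 0\,0\,1^{n-2}\,\overline{x}_1\; 0\,0\,1^{n-2}\,\overline{x}_2 \cdots 0\,0\,1^{n-2}\,\overline{x}_{n!}$, where $\overline{x}$ is the complement of the bit $x$, $1^{m}$ denotes $m$ copies of $1$ and $1^0$ is empty (so $S_3 = 001001$). The map $\phi$ sends the bit $0$ to $\sigma_n$ and the bit $1$ to $\sigma_{n-1}$.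 *)

theory Defs
  imports "HOL-Combinatorics.Multiset_Permutations" "Graph_Theory.Graph_Theory"
begin

text \<open>
  A permutation of \<open>{1..n}\<close> is represented by its one-line notation, that is, by an element of
  \<open>permutations_of_set {1..n}\<close>.
\<close>

text \<open>
  \<open>sigma k\<close> sends \<open>x\<^sub>1 x\<^sub>2 \<dots> x\<^sub>n\<close> to \<open>x\<^sub>2 \<dots> x\<^sub>k x\<^sub>1 x\<^sub>k\<^sub>+\<^sub>1 \<dots> x\<^sub>n\<close>: the cycle \<open>(1 2 \<dots> k)\<close> acts on
  positions, not on values.
\<close>

definition sigma :: "nat \<Rightarrow> 'a list \<Rightarrow> 'a list" where
  "sigma k xs = rotate1 (take k xs) @ drop k xs"

text \<open>
  Arcs are plain pairs of vertices. For \<open>n = 2\<close> the generator \<open>sigma (n - 1)\<close> is the identity, so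
  the graph then has a loop at each vertex.
\<close>

definition Xi :: "nat \<Rightarrow> nat list pair_pre_digraph" where
  "Xi n = \<lparr> pverts = permutations_of_set {1..n},
            parcs = {(g, sigma k g) | g k. g \<in> permutations_of_set {1..n} \<and> k \<in> {n, n - 1}} \<rparr>"

text \<open>
  The bits 0 and 1 are \<open>False\<close> and \<open>True\<close>. The string \<open>S n\<close> is meaningful only for \<open>n \<ge> 2\<close>; in the
  last equation the index on the left is \<open>n + 1\<close> with \<open>n = m + 2\<close>, hence \<open>n - 2 = m\<close>.
\<close>

fun S :: "nat \<Rightarrow> bool list" where
  "S 0 = []"
| "S (Suc 0) = []"
| "S (Suc (Suc 0)) = [False, False]"
| "S (Suc (Suc (Suc m))) =
     concat (map (\<lambda>x. [False, False] @ replicate m True @ [\<not> x]) (S (Suc (Suc m))))"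

definition phi :: "nat \<Rightarrow> bool \<Rightarrow> 'a list \<Rightarrow> 'a list" where
  "phi n b = (if b then sigma (n - 1) else sigma n)"

text \<open>
  All permutations met when applying the images under \<open>phi n\<close> of the given bits in succession,
  including the starting one and the final one.
\<close>

primrec phi_walk :: "nat \<Rightarrow> bool list \<Rightarrow> 'a list \<Rightarrow> 'a list list" where
  "phi_walk n [] g = [g]"
| "phi_walk n (b # bs) g = g # phi_walk n bs (phi n b g)"

definition hamilton_cycle :: "('a, 'b) pre_digraph \<Rightarrow> 'b list \<Rightarrow> bool" where
  "hamilton_cycle G p \<longleftrightarrow> pre_digraph.cycle G p \<and> tail G ` set p = verts G"

end

theory Submission
  imports Defs
begin

text \<open>
  Write \<open>a = n + 1\<close>. Started at \<open>a w\<close>, with \<open>w\<close> a permutation of \<open>{1..n}\<close>, the block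
  \<open>0 0 1\<^sup>n\<^sup>-\<^sup>2 \<not>x\<close> of \<open>S (n + 1)\<close> leads to \<open>a w'\<close>, where \<open>w'\<close> arises from \<open>w\<close> by the generator
  that \<open>x\<close> encodes on \<open>{1..n}\<close>. So the walk of \<open>S (n + 1)\<close> restricted to the block starts is the
  walk of \<open>S n\<close> with \<open>a\<close> prepended. In between, the block visits \<open>w a\<close>
  and the words \<open>u a v w\<^sub>1\<close> with \<open>w = w\<^sub>1 v u\<close> and \<open>u\<close> nonempty. Every permutation of
  \<open>{1..n + 1}\<close> has one of these three forms, so all of them are visited by induction; since only
  \<open>(n + 1)!\<close> steps are made, none is visited twice.
\<close>

lemma length_sigma [simp]: "length (sigma k xs) = length xs"
  by (simp add: sigma_def)

lemma mset_sigma [simp]: "mset (sigma k xs) = mset xs"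
proof -
  have "mset (rotate1 ys) = mset ys" for ys :: "'a list"
    by (cases ys) simp_all
  then show ?thesis
    by (metis append_take_drop_id mset_append sigma_def)
qed

lemma sigma_append: "length xs = k \<Longrightarrow> sigma k (xs @ ys) = rotate1 xs @ ys"
  by (simp add: sigma_def)

lemma sigma_length: "length xs = k \<Longrightarrow> sigma k xs = rotate1 xs"
  by (simp add: sigma_def)

lemma length_phi [simp]: "length (phi n b xs) = length xs"
  by (simp add: phi_def)

lemma mset_phi [simp]: "mset (phi n b xs) = mset xs"
  by (simp add: phi_def)

lemma phi_in_permutations_of_set:
  "g \<in> permutations_of_set A \<Longrightarrow> phi n b g \<in> permutations_of_set A"
  using mset_eq_setD[OF mset_phi[of n b g]] mset_eq_imp_distinct_iff[OF mset_phi[of n b g]]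
  by (simp add: permutations_of_set_def)

lemma phi_walk_neq_Nil [simp]: "phi_walk n bs g \<noteq> []"
  by (cases bs) auto

lemma hd_phi_walk [simp]: "hd (phi_walk n bs g) = g"
  by (cases bs) auto

lemma last_phi_walk: "last (phi_walk n bs g) = fold (phi n) bs g"
  by (induction bs arbitrary: g) auto

lemma length_phi_walk [simp]: "length (phi_walk n bs g) = Suc (length bs)"
  by (induction bs arbitrary: g) auto

lemma butlast_phi_walk_append:
  "butlast (phi_walk n (as @ bs) g) =
     butlast (phi_walk n as g) @ butlast (phi_walk n bs (fold (phi n) as g))"
  by (induction as arbitrary: g) auto

text \<open>To see that a word is visited, it is enough to reach it by a proper prefix of the bits;
  \<open>bs \<noteq> []\<close> matters because \<open>butlast\<close> drops the final word.\<close>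

lemma fold_phi_in_butlast_phi_walk:
  "bs \<noteq> [] \<Longrightarrow> fold (phi n) as g \<in> set (butlast (phi_walk n (as @ bs) g))"
  by (cases bs) (simp_all add: butlast_phi_walk_append)

section \<open>Walks as arc lists in the digraph\<close>

lemma set_phi_walk_subset_permutations_of_set:
  "g \<in> permutations_of_set A \<Longrightarrow> set (phi_walk n bs g) \<subseteq> permutations_of_set A"
  by (induction bs arbitrary: g) (auto dest: phi_in_permutations_of_set)

lemma arcs_phi_walk:
  "g \<in> permutations_of_set {1..n} \<Longrightarrow> set (vwalk_arcs (phi_walk n bs g)) \<subseteq> parcs (Xi n)"
proof (induction bs arbitrary: g)
  case (Cons b bs)
  have "(g, phi n b g) \<in> parcs (Xi n)"
    using Cons.prems by (auto simp: Xi_def phi_def)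
  with Cons show ?case
    by (auto dest: phi_in_permutations_of_set)
qed auto

lemma pcas_vwalk_arcs: "p \<noteq> [] \<Longrightarrow> pcas (hd p) (vwalk_arcs p) (last p)"
  by (induction p rule: vwalk_arcs.induct) auto

lemma pawalk_verts_vwalk_arcs: "p \<noteq> [] \<Longrightarrow> pawalk_verts (hd p) (vwalk_arcs p) = p"
  by (induction p rule: vwalk_arcs.induct) auto

text \<open>Translates the condition on tails in \<open>hamilton_cycle\<close> into one on the
  visited words.\<close>

lemma fst_vwalk_arcs: "map fst (vwalk_arcs p) = butlast p"
  by (induction p rule: vwalk_arcs.induct) auto

text \<open>Cycles ask for a distinct \<open>tl\<close>, whereas counting yields a distinct
  \<open>butlast\<close>; on a closed walk both drop one copy of the same endpoint.\<close>

lemma distinct_tl_closed: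
  "\<lbrakk>hd p = last p; distinct (butlast p)\<rbrakk> \<Longrightarrow> distinct (tl p)"
  by (cases p; cases "tl p" rule: rev_cases) auto

section \<open>The action of one block\<close>

definition block :: "nat \<Rightarrow> bool \<Rightarrow> bool list" where
  "block m x = [False, False] @ replicate m True @ [\<not> x]"

lemma S_block: "S (m + 3) = concat (map (block m) (S (m + 2)))"
  by (simp add: numeral_3_eq_3 block_def[abs_def])

lemma fold_phi_replicate_True:
  "length xs = n \<Longrightarrow>
     fold (phi (Suc n)) (replicate k True) (xs @ [x]) = rotate k xs @ [x]"
  by (induction k arbitrary: xs) (simp_all add: phi_def sigma_append rotate1_rotate_swap)

text \<open>The two bits 0 rotate \<open>a y w\<close> to \<open>w a y\<close>; each bit 1 then
  rotates \<open>w a\<close> and fixes \<open>y\<close>. Leaving \<open>k\<close> free also covers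
  the words inside a block.\<close>

lemma fold_phi_block_prefix:
  assumes "length w = m + 1"
  shows "fold (phi (m + 3)) ([False, False] @ replicate k True) (a # y # w)
    = rotate k (w @ [a]) @ [y]"
  using fold_phi_replicate_True[of "w @ [a]" "m + 2" k y] assms
  by (simp add: phi_def sigma_length numeral_3_eq_3)

text \<open>For \<open>w = y v z\<close> the word before the last bit is \<open>z a v y\<close>.
  That bit moves \<open>z\<close> to just before \<open>y\<close> (bit 1) or behind it (bit 0),
  giving \<open>a v z y\<close> or \<open>a v y z\<close>. These are \<open>a\<close> followed by
  the long and the short rotation of \<open>w\<close>, hence the complement.\<close>

lemma fold_phi_block:
  assumes "length w = m + 2"
  shows "fold (phi (m + 3)) (block m x) (a # w) = a # phi (m + 2) x w"
proof -
  from assms obtain y v z where w: "w = y # v @ [z]" and v: "length v = m"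
    by (metis add_2_eq_Suc' length_Suc_conv length_Suc_conv_rev)
  have "fold (phi (m + 3)) (block m x) (a # w)
    = phi (m + 3) (\<not> x) (rotate m (v @ [z, a]) @ [y])"
    using fold_phi_block_prefix[of "v @ [z]" m m a y] v unfolding block_def w by simp
  also have "rotate m (v @ [z, a]) = [z, a] @ v"
    using v by (metis rotate_append)
  also have "phi (m + 3) (\<not> x) (([z, a] @ v) @ [y]) = a # phi (m + 2) x w"
    using v sigma_append[of "z # a # v" "m + 2" "[y]"] sigma_append[of "y # v" "m + 1" "[z]"]
    by (auto simp: phi_def sigma_length w numeral_3_eq_3)
  finally show ?thesis .
qed

lemma fold_phi_concat_block:
  "length w = m + 2 \<Longrightarrow>
     fold (phi (m + 3)) (concat (map (block m) bs)) (a # w) = a # fold (phi (m + 2)) bs w"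
  by (induction bs arbitrary: w) (simp_all add: fold_phi_block)

section \<open>Words visited inside the blocks\<close>

text \<open>The bit read at \<open>v\<close> is not known, hence the existential; it does no harm,
  since the visits shown below occur for every \<open>x\<close>.\<close>

lemma concat_block_visits:
  assumes "length w = m + 2" and "v \<in> set (butlast (phi_walk (m + 2) bs w))"
  shows "\<exists>x. set (butlast (phi_walk (m + 3) (block m x) (a # v)))
    \<subseteq> set (butlast (phi_walk (m + 3) (concat (map (block m) bs)) (a # w)))"
  using assms
proof (induction bs arbitrary: w)
  case (Cons b bs)
  have split: "set (butlast (phi_walk (m + 3) (concat (map (block m) (b # bs))) (a # w)))
    = set (butlast (phi_walk (m + 3) (block m b) (a # w)))
      \<union> set (butlast (phi_walk (m + 3) (concat (map (block m) bs)) (a # phi (m + 2) b w)))"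
    using Cons.prems(1) by (simp add: butlast_phi_walk_append fold_phi_block)
  show ?case
  proof (cases "v = w")
    case True
    then show ?thesis
      unfolding split by blast
  next
    case False
    then have "v \<in> set (butlast (phi_walk (m + 2) bs (phi (m + 2) b w)))"
      using Cons.prems(2) by simp
    from Cons.IH[OF _ this] Cons.prems(1) show ?thesis
      unfolding split by (simp only: length_phi) blast
  qed
qed simp

lemma block_visits_first: "a # w \<in> set (butlast (phi_walk n (block m x) (a # w)))"
  by (simp add: block_def)

lemma block_visits_last:
  assumes "length w = m + 2"
  shows "w @ [a] \<in> set (butlast (phi_walk (m + 3) (block m x) (a # w)))"
proof -
  have "fold (phi (m + 3)) [False] (a # w) = w @ [a]"
    using assms by (simp add: phi_def sigma_length)
  with fold_phi_in_butlast_phi_walk[of "False # replicate m True @ [\<not> x]" "m + 3" "[False]" "a # w"]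
  show ?thesis by (simp add: block_def)
qed

text \<open>After \<open>00\<close> the word is \<open>v u a y\<close>, and \<open>length v\<close>
  bits 1 bring \<open>v\<close> behind \<open>u a\<close>. As \<open>u\<close> is nonempty,
  \<open>length v \<le> m\<close>, so the block has enough of them.\<close>

lemma block_visits_inner:
  assumes "length (u @ v) = m + 1" and "u \<noteq> []"
  shows "u @ a # v @ [y] \<in> set (butlast (phi_walk (m + 3) (block m x) (a # y # v @ u)))"
proof -
  let ?k = "length v"
  have "?k \<le> m"
    using assms by (cases u) auto
  then have "block m x = ([False, False] @ replicate ?k True) @ replicate (m - ?k) True @ [\<not> x]"
    unfolding block_def by (simp flip: replicate_add)
  moreover have "fold (phi (m + 3)) ([False, False] @ replicate ?k True) (a # y # v @ u)
      = u @ a # v @ [y]"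
    using fold_phi_block_prefix[of "v @ u" m ?k a y] rotate_append[of v "u @ [a]"] assms(1)
    by simp
  ultimately show ?thesis
    by (metis fold_phi_in_butlast_phi_walk snoc_eq_iff_butlast)
qed

lemma permutations_of_set_visited_Suc:
  assumes w: "length w = m + 2" and A: "card A = m + 2" and "a \<notin> A"
    and visited: "permutations_of_set A \<subseteq> set (butlast (phi_walk (m + 2) bs w))"
  shows "permutations_of_set (insert a A)
    \<subseteq> set (butlast (phi_walk (m + 3) (concat (map (block m) bs)) (a # w)))" (is "_ \<subseteq> ?V")
proof
  fix p assume p: "p \<in> permutations_of_set (insert a A)"
  then obtain u v where uv: "p = u @ a # v"
    by (metis insertI1 permutations_of_setD(1) split_list)
  from p \<open>a \<notin> A\<close> have *: "set (u @ v) = A" "distinct (u @ v)"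
    by (auto simp: uv permutations_of_set_def)
  have len: "length (u @ v) = m + 2"
    using * A distinct_card by metis
  have visit: "p \<in> ?V"
    if "q \<in> permutations_of_set A"
      and "\<And>x. p \<in> set (butlast (phi_walk (m + 3) (block m x) (a # q)))" for q
    using concat_block_visits[OF w, of q bs a] that visited by blast
  \<comment> \<open>The cases correspond to the start of a block, the word after its first 0, and
    the words from its second 0 onwards.\<close>
  consider "u = []" | "v = []" | y v' where "u \<noteq> []" "v = v' @ [y]"
    by (cases v rule: rev_cases) auto
  then show "p \<in> ?V"
  proof cases
    case 1
    then show ?thesis
      using * by (intro visit[of v]) (auto simp: uv permutations_of_set_def block_visits_first)
  next
    case 2
    then show ?thesis
      using * len
      by (intro visit[of u]) (auto simp: uv permutations_of_set_def block_visits_last)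
  next
    case 3
    have "p \<in> set (butlast (phi_walk (m + 3) (block m x) (a # y # v' @ u)))" for x
      using block_visits_inner[of u v' m a y x] 3 len uv by simp
    moreover have "y # v' @ u \<in> permutations_of_set A"
      using * 3 by (auto simp: permutations_of_set_def)
    ultimately show ?thesis
      by (intro visit[of "y # v' @ u"])
  qed
qed

section \<open>Induction along the recursion of \<open>S\<close>\<close>

lemma length_S: "length (S (m + 2)) = fact (m + 2)"
proof (induction m)
  case (Suc m)
  have "length (concat (map (block m) bs)) = (m + 3) * length bs" for bs
    by (induction bs) (simp_all add: block_def)
  with Suc S_block[of m] show ?case
    by (simp add: numeral_3_eq_3)
qed (simp add: numeral_2_eq_2)

lemma fold_phi_S:
  "fold (phi (m + 2)) (S (m + 2)) (rev [1..<m + 3]) = rev [1..<m + 3]"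
proof (induction m)
  case 0
  show ?case by (simp add: numeral_2_eq_2 numeral_3_eq_3 phi_def sigma_def)
next
  case (Suc m)
  have "rev [1..<Suc m + 3] = (m + 3) # rev [1..<m + 3]"
    using upt_Suc_append[of 1 "m + 3"] by simp
  with Suc S_block[of m] fold_phi_concat_block[of "rev [1..<m + 3]" m "S (m + 2)" "m + 3"]
  show ?case by (simp add: numeral_3_eq_3)
qed

lemma permutations_of_set_visited:
  "permutations_of_set {1..m + 2}
     \<subseteq> set (butlast (phi_walk (m + 2) (S (m + 2)) (rev [1..<m + 3])))"
proof (induction m)
  case 0
  have "{1..2} = {1::nat, 2}" by auto
  then show ?case
    by (auto simp: numeral_2_eq_2 numeral_3_eq_3 phi_def sigma_def permutations_of_set_doubleton)
next
  case (Suc m)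
  have "{1..Suc m + 2} = insert (m + 3) {1..m + 2}"
    by auto
  moreover have "rev [1..<Suc m + 3] = (m + 3) # rev [1..<m + 3]"
    using upt_Suc_append[of 1 "m + 3"] by simp
  ultimately show ?case
    using permutations_of_set_visited_Suc[OF _ _ _ Suc, of "m + 3"] S_block[of m]
    by (simp add: numeral_3_eq_3)
qed

theorem theorem1:
  fixes n :: nat and start :: "nat list" and visited :: "nat list list"
  assumes "n \<ge> 2"
  defines "start \<equiv> rev [1..<n + 1]"
  defines "visited \<equiv> phi_walk n (S n) start"
  shows "hamilton_cycle (with_proj (Xi n)) (vwalk_arcs visited)
    \<and> length (S n) = fact n
    \<and> hd visited = start
    \<and> distinct (butlast visited)
    \<and> set (butlast visited) = permutations_of_set {1..n}
    \<and> last visited = start"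
proof -
  obtain m where m: "n = m + 2"
    using assms(1) by (metis add.commute le_Suc_ex)
  have start_in: "start \<in> permutations_of_set {1..n}"
    by (auto simp: start_def permutations_of_set_def)
  have len: "length (S n) = fact n"
    unfolding m by (rule length_S)
  have hd: "hd visited = start"
    by (simp add: visited_def)
  have last: "last visited = start"
    using fold_phi_S[of m] by (simp add: visited_def start_def last_phi_walk m numeral_3_eq_3)
  have sup: "permutations_of_set {1..n} \<subseteq> set (butlast visited)"
    using permutations_of_set_visited[of m] by (simp add: visited_def start_def m numeral_3_eq_3)
  have sub: "set visited \<subseteq> permutations_of_set {1..n}"
    unfolding visited_def by (rule set_phi_walk_subset_permutations_of_set[OF start_in])
  have set: "set (butlast visited) = permutations_of_set {1..n}"
    using sup sub by (auto dest: in_set_butlastD)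
  \<comment> \<open>The list has \<open>fact n\<close> entries and its set has \<open>fact n\<close>
    elements, so nothing repeats.\<close>
  have distinct: "distinct (butlast visited)"
    by (rule card_distinct) (simp add: set, simp add: visited_def len)
  have nonempty: "visited \<noteq> []"
    by (simp add: visited_def)
  have "pre_digraph.cycle (with_proj (Xi n)) (vwalk_arcs visited)"
    unfolding pre_digraph.cycle_def pre_digraph.awalk_def
  proof (intro exI[of _ start] conjI)
    show "start \<in> verts (with_proj (Xi n))"
      using start_in by (simp add: Xi_def)
    show "set (vwalk_arcs visited) \<subseteq> arcs (with_proj (Xi n))"
      using arcs_phi_walk[OF start_in] by (simp add: visited_def)
    show "pre_digraph.cas (with_proj (Xi n)) start (vwalk_arcs visited) start"
      using pcas_vwalk_arcs[OF nonempty] by (simp add: hd last cas_with_proj_eq)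
    show "distinct (tl (pre_digraph.awalk_verts (with_proj (Xi n)) start (vwalk_arcs visited)))"
      using pawalk_verts_vwalk_arcs[OF nonempty] distinct_tl_closed[OF _ distinct]
      by (simp add: hd last awalk_verts_with_proj_eq)
    \<comment> \<open>The tails of the arcs form \<open>butlast visited\<close>, which contains
      \<open>start\<close>.\<close>
    show "vwalk_arcs visited \<noteq> []"
      using fst_vwalk_arcs[of visited] set start_in by auto
  qed
  moreover have "fst ` set (vwalk_arcs visited) = permutations_of_set {1..n}"
    using fst_vwalk_arcs[of visited] set by (metis set_map)
  ultimately have "hamilton_cycle (with_proj (Xi n)) (vwalk_arcs visited)"
    by (simp add: hamilton_cycle_def Xi_def)
  with len hd distinct set last show ?thesis by blast
qed

end
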